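(* If a nonempty space $X$ is strongly rectifiable, then $X$ is rectifiable.
   Context: A space means a regular topological space. A space $X$ is rectifiable if there exist a point $e\in X$ and a homeomorphism $\Psi:X^2\to X^2$ of the form $\Psi(x,y)=(x,p(x,y))$ for some map $p:X^2\to X$ with $p(x,x)=e$ for all $x\in X$. A space $X$ is strongly rectifiable if there exists a strong Mal'tsev operation on $X$, i.e. a continuous map $P:X^3\to X$ such that $P(x,y,y)=P(y,y,x)=x$ and $P(x,y,P(y,z,u))=P(x,z,u)$ for all $x,y,z,u\in X$. *)

theory Defs
  imports "HOL-Analysis.Analysis"
begin

text \<open>
  Spaces are abstract topologies, so that the empty space is included. Regularity is not part of
  the definitions below; it is a hypothesis wherever these notions are applied.
\<close>

text \<open>Here \<open>p\<close> is an arbitrary map; it is automatically continuous, being the second component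
  of \<open>\<Psi>\<close> on \<open>topspace X \<times> topspace X\<close>.\<close>

definition rectifiable_space :: "'a topology \<Rightarrow> bool" where
  "rectifiable_space X \<longleftrightarrow>
     (\<exists>e\<in>topspace X. \<exists>\<Psi> p.
        homeomorphic_map (prod_topology X X) (prod_topology X X) \<Psi> \<and>
        p \<in> topspace X \<times> topspace X \<rightarrow> topspace X \<and>
        (\<forall>x\<in>topspace X. \<forall>y\<in>topspace X. \<Psi> (x, y) = (x, p (x, y))) \<and>
        (\<forall>x\<in>topspace X. p (x, x) = e))"

definition strong_maltsev_operation :: "'a topology \<Rightarrow> ('a \<times> 'a \<times> 'a \<Rightarrow> 'a) \<Rightarrow> bool" where
  "strong_maltsev_operation X P \<longleftrightarrow>
     continuous_map (prod_topology X (prod_topology X X)) X P \<and>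
     (\<forall>x\<in>topspace X. \<forall>y\<in>topspace X. P (x, y, y) = x \<and> P (y, y, x) = x) \<and>
     (\<forall>x\<in>topspace X. \<forall>y\<in>topspace X. \<forall>z\<in>topspace X. \<forall>u\<in>topspace X.
        P (x, y, P (y, z, u)) = P (x, z, u))"

definition strongly_rectifiable_space :: "'a topology \<Rightarrow> bool" where
  "strongly_rectifiable_space X \<longleftrightarrow> (\<exists>P. strong_maltsev_operation X P)"

end

theory Submission imports Defs begin

text \<open>
  Fix \<open>e\<close> and put \<open>p (x, y) = P (e, x, y)\<close>. The composition law of \<open>P\<close> makes
  \<open>(x, y) \<mapsto> (x, P (x, e, y))\<close> a continuous two-sided inverse of \<open>(x, y) \<mapsto> (x, p (x, y))\<close>.
\<close>

text \<open>Leaving \<open>f\<close> and \<open>g\<close> arbitrary lets one statement serve both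
  directions of the homeomorphism: \<open>f\<close> constant and \<open>g\<close> the identity give
  the map itself, and exchanging the two gives its inverse.\<close>

lemma continuous_map_shear:
  assumes P: "continuous_map (prod_topology X (prod_topology X X)) X P"
    and f: "continuous_map X X f" and g: "continuous_map X X g"
  shows "continuous_map (prod_topology X X) (prod_topology X X)
           (\<lambda>z. (fst z, P (f (fst z), g (fst z), snd z)))"
proof -
  have fst: "continuous_map (prod_topology X X) X (\<lambda>z. h (fst z))" if "continuous_map X X h" for h
    using continuous_map_compose[OF continuous_map_fst that] by (simp add: o_def)
  have "continuous_map (prod_topology X X) (prod_topology X (prod_topology X X))
          (\<lambda>z. (f (fst z), g (fst z), snd z))"
    by (intro continuous_map_pairedI fst f g continuous_map_snd)
  from continuous_map_compose[OF this P] show ?thesis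
    by (intro continuous_map_pairedI continuous_map_fst) (simp add: o_def)
qed

theorem proposition2:
  fixes X :: "'a topology"
  assumes "regular_space X"
    and "topspace X \<noteq> {}"
    and "strongly_rectifiable_space X"
  shows "rectifiable_space X"
proof -
  obtain e where e: "e \<in> topspace X"
    using assms(2) by blast
  obtain P where cont: "continuous_map (prod_topology X (prod_topology X X)) X P"
    and maltsev: "\<And>x y. x \<in> topspace X \<Longrightarrow> y \<in> topspace X \<Longrightarrow> P (x, y, y) = x \<and> P (y, y, x) = x"
    and comp: "\<And>x y z u. x \<in> topspace X \<Longrightarrow> y \<in> topspace X \<Longrightarrow> z \<in> topspace X \<Longrightarrow>
      u \<in> topspace X \<Longrightarrow> P (x, y, P (y, z, u)) = P (x, z, u)"
    using assms(3) unfolding strongly_rectifiable_space_def strong_maltsev_operation_def by auto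
  have const: "continuous_map X X (\<lambda>_. e)"
    using e by simp
  have ident: "continuous_map X X (\<lambda>x. x)"
    by simp
  \<comment> \<open>In each composite, \<open>comp\<close> cancels the adjacent equal entries and a
    Mal'tsev identity finishes: \<open>P (x, e, P (e, x, y)) = P (x, x, y) = y\<close> and
    \<open>P (e, x, P (x, e, y)) = P (e, e, y) = y\<close>.\<close>
  have "homeomorphic_maps (prod_topology X X) (prod_topology X X)
          (\<lambda>z. (fst z, P (e, fst z, snd z))) (\<lambda>z. (fst z, P (fst z, e, snd z)))"
    using continuous_map_shear[OF cont const ident] continuous_map_shear[OF cont ident const]
    by (simp add: homeomorphic_maps_def comp maltsev e)
  then have "homeomorphic_map (prod_topology X X) (prod_topology X X)
      (\<lambda>z. (fst z, P (e, fst z, snd z)))"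
    by (rule homeomorphic_maps_map[THEN iffD1, THEN conjunct1])
  moreover have "(\<lambda>z. P (e, fst z, snd z)) \<in> topspace X \<times> topspace X \<rightarrow> topspace X"
    using cont e by (auto simp: continuous_map_def Pi_iff)
  \<comment> \<open>The diagonal condition is the other Mal'tsev identity,
    \<open>P (e, x, x) = e\<close>, so the chosen \<open>e\<close> is also the distinguished point
    of the rectification.\<close>
  ultimately show ?thesis
    unfolding rectifiable_space_def
    by (intro bexI[OF _ e] exI[of _ "\<lambda>z. (fst z, P (e, fst z, snd z))"]
        exI[of _ "\<lambda>z. P (e, fst z, snd z)"]) (simp add: maltsev e)
qed

end
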